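(* Let $A\in\mathbb{R}^{n\times n}$ be an $\tilde{E}_0^s$-matrix with $v(A)>0$. Then for every $q\in\mathbb{R}^n$ the solution set $\mathrm{SOL}(q,A)$ is compact.
   Context: Vector inequalities are componentwise. $\mathrm{SOL}(q,A)=\{z\in\mathbb{R}^n: z\ge 0,\ q+Az\ge 0,\ z^T(q+Az)=0\}$ is the solution set of the linear complementarity problem LCP$(q,A)$. $v(A)$ denotes the value of the two-person zero-sum matrix game with pay-off matrix $A$; $v(A)>0$ if and only if there exists $0\neq x\ge 0$ with $Ax>0$. $A$ is semimonotone ($E_0$) if for every $0\neq x\ge 0$ there is $i$ with $x_i>0$ and $(Ax)_i\ge 0$. $A\in E_0^s$ if $A\in E_0$ and $x\ge 0$, $Ax\ge 0$, $x^TAx=0$ imply $A^Tx\le 0$. $A\in\tilde{E}_0^s$ if $A\in E_0^s$ and for every $x\in \mathrm{SOL}(0,A)$ and every index $i$, $(A^Tx)_i\neq 0$ implies $(Ax)_i\neq 0$. *)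

theory Defs
  imports "HOL-Analysis.Analysis"
begin

definition LCP_SOL :: "real ^ 'n \<Rightarrow> real ^ 'n ^ 'n \<Rightarrow> (real ^ 'n) set" where
  "LCP_SOL q A = {z. 0 \<le> z \<and> 0 \<le> q + A *v z \<and> z \<bullet> (q + A *v z) = 0}"

definition mixed_strategies :: "(real ^ 'n) set" where
  "mixed_strategies = {x. 0 \<le> x \<and> (\<Sum>i\<in>UNIV. x $ i) = 1}"

(* Value of the matrix game with pay-off matrix A. The column player maximizes and the row
   player minimizes; with this convention the value is positive iff A *v x is positive in
   every component for some nonzero x \<ge> 0. The inner products are bounded on the (compact)
   strategy sets, so SUP and INF on the reals are the genuine supremum and infimum (in fact a
   maximum and a minimum), and by von Neumann's theorem they may be interchanged. *)
definition game_value :: "real ^ 'n ^ 'm \<Rightarrow> real" where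
  "game_value A = (SUP x\<in>mixed_strategies. INF y\<in>mixed_strategies. y \<bullet> (A *v x))"

definition semimonotone :: "real ^ 'n ^ 'n \<Rightarrow> bool" where
  "semimonotone A \<longleftrightarrow>
     (\<forall>x. x \<noteq> 0 \<and> 0 \<le> x \<longrightarrow> (\<exists>i. x $ i > 0 \<and> (A *v x) $ i \<ge> 0))"

definition E0s_matrix :: "real ^ 'n ^ 'n \<Rightarrow> bool" where
  "E0s_matrix A \<longleftrightarrow> semimonotone A \<and>
     (\<forall>x. 0 \<le> x \<and> 0 \<le> A *v x \<and> x \<bullet> (A *v x) = 0 \<longrightarrow> transpose A *v x \<le> 0)"

definition E0s_tilde_matrix :: "real ^ 'n ^ 'n \<Rightarrow> bool" where
  "E0s_tilde_matrix A \<longleftrightarrow> E0s_matrix A \<and>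
     (\<forall>x\<in>LCP_SOL 0 A. \<forall>i. (transpose A *v x) $ i \<noteq> 0 \<longrightarrow> (A *v x) $ i \<noteq> 0)"

end

theory Submission
  imports Defs
begin

text \<open>
  A positive game value yields \<open>y \<ge> 0\<close> with \<open>A y > 0\<close>. If \<open>x \<noteq> 0\<close> solved the homogeneous
  problem, then \<open>A\<^sup>T x \<le> 0\<close> would give \<open>0 < x \<bullet> A y = A\<^sup>T x \<bullet> y \<le> 0\<close>; so the homogeneous problem
  has only the zero solution. Rescaling solutions of LCP\<open>(q, A)\<close> to the unit sphere turns \<open>q\<close>
  into \<open>t q\<close> with \<open>t = 1 / \<parallel>z\<parallel>\<close>, and compactness keeps \<open>t\<close> away from \<open>0\<close>.
\<close>

lemma axis_in_mixed_strategies: "axis i 1 \<in> mixed_strategies"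
  by (simp add: mixed_strategies_def less_eq_vec_def axis_def)

text \<open>A mixed strategy averages the components of \<open>w\<close>, each at least
  \<open>- norm w\<close>. Without such a bound the real-valued \<open>INF\<close> need not be a
  lower bound.\<close>

lemma bdd_below_mixed_strategies_inner:
  fixes w :: "real ^ 'n"
  shows "bdd_below ((\<lambda>y. y \<bullet> w) ` mixed_strategies)"
proof (rule bdd_belowI2)
  fix y :: "real ^ 'n"
  assume "y \<in> mixed_strategies"
  then have y: "\<And>i. 0 \<le> y $ i" "(\<Sum>i\<in>UNIV. y $ i) = 1"
    by (auto simp: mixed_strategies_def less_eq_vec_def)
  have "- norm w = (\<Sum>i\<in>UNIV. y $ i * - norm w)"
    by (simp only: sum_distrib_right[symmetric] y(2) mult_1)
  also have "\<dots> \<le> (\<Sum>i\<in>UNIV. y $ i * w $ i)"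
  proof (intro sum_mono mult_left_mono y)
    show "- norm w \<le> w $ i" for i
      using component_le_norm_cart[of w i] by linarith
  qed
  finally show "- norm w \<le> y \<bullet> w"
    by (simp add: inner_vec_def)
qed

text \<open>A positive supremum forces some strategy \<open>x\<close> with positive guaranteed
  payoff; testing it against the pure strategies \<open>axis i 1\<close> reads off the components of
  \<open>A *v x\<close>.\<close>

lemma game_value_pos_imp_positive_vector:
  fixes A :: "real ^ 'n ^ 'm"
  assumes "game_value A > 0"
  obtains x where "0 \<le> x" "\<And>i. (A *v x) $ i > 0"
proof -
  let ?f = "\<lambda>x. INF y\<in>mixed_strategies. y \<bullet> (A *v x)"
  have "\<exists>x\<in>mixed_strategies. ?f x > 0"
  proof (rule ccontr)
    assume "\<not> ?thesis"
    then have "game_value A \<le> 0"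
      unfolding game_value_def
      by (intro cSUP_least) (use axis_in_mixed_strategies in \<open>auto simp: not_less\<close>)
    with assms show False by simp
  qed
  then obtain x where x: "x \<in> mixed_strategies" "?f x > 0" by blast
  have "(A *v x) $ i > 0" for i
  proof -
    have "?f x \<le> axis i 1 \<bullet> (A *v x)"
      by (intro cINF_lower bdd_below_mixed_strategies_inner axis_in_mixed_strategies)
    with x(2) show ?thesis by (simp add: inner_axis')
  qed
  with x(1) that show ?thesis by (auto simp: mixed_strategies_def)
qed

lemma E0s_matrix_LCP_SOL_zero:
  fixes A :: "real ^ 'n ^ 'n"
  assumes "E0s_matrix A" "game_value A > 0"
  shows "LCP_SOL 0 A \<subseteq> {0}"
proof
  fix x assume "x \<in> LCP_SOL 0 A"
  then have x: "0 \<le> x" "0 \<le> A *v x" "x \<bullet> (A *v x) = 0"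
    by (auto simp: LCP_SOL_def)
  with assms(1) have le: "transpose A *v x \<le> 0"
    by (auto simp: E0s_matrix_def)
  obtain y where y: "0 \<le> y" "\<And>i. (A *v y) $ i > 0"
    using game_value_pos_imp_positive_vector[OF assms(2)] by blast
  have nonneg: "0 \<le> x $ i * (A *v y) $ i" for i
    using x(1) y(2)[of i] by (simp add: less_eq_vec_def)
  have "x \<bullet> (A *v y) = (transpose A *v x) \<bullet> y"
    by (simp add: dot_lmul_matrix)
  also have "\<dots> \<le> 0"
    using le y(1) by (auto simp: inner_vec_def less_eq_vec_def intro!: sum_nonpos mult_nonpos_nonneg)
  finally have "(\<Sum>i\<in>UNIV. x $ i * (A *v y) $ i) = 0"
    using nonneg by (intro antisym sum_nonneg) (auto simp: inner_vec_def)
  then have "x $ i * (A *v y) $ i = 0" for i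
    using nonneg by (simp add: sum_nonneg_eq_0_iff)
  then have "x $ i = 0" for i
    using y(2)[of i] by (metis mult_eq_0_iff less_irrefl)
  then show "x \<in> {0}" by (simp add: vec_eq_iff)
qed

text \<open>Closedness jointly in \<open>q\<close> and \<open>z\<close> is what the boundedness
  argument uses, since there the right-hand side varies along \<open>t *\<^sub>R q\<close>.\<close>

lemma closed_LCP_SOL_graph:
  fixes A :: "real ^ 'n ^ 'n"
  shows "closed {(q, z). z \<in> LCP_SOL q A}"
  unfolding LCP_SOL_def less_eq_vec_def case_prod_unfold mem_Collect_eq
  by (intro closed_Collect_conj closed_Collect_all closed_Collect_le closed_Collect_eq
      continuous_intros matrix_vector_mult_linear_continuous_on
      continuous_on_compose2[OF matrix_vector_mult_linear_continuous_on[of UNIV A]]) auto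

lemma closed_LCP_SOL: "closed (LCP_SOL q A)"
proof -
  have "closed (Pair q -` {(q, z). z \<in> LCP_SOL q A})"
    by (intro closed_vimage closed_LCP_SOL_graph continuous_intros)
  then show ?thesis by (simp add: vimage_def)
qed

lemma LCP_SOL_scaleR:
  assumes "z \<in> LCP_SOL q A" "0 \<le> t"
  shows "t *\<^sub>R z \<in> LCP_SOL (t *\<^sub>R q) A"
proof -
  have "t *\<^sub>R q + A *v (t *\<^sub>R z) = t *\<^sub>R (q + A *v z)"
    by (simp add: matrix_vector_mult_scaleR scaleR_add_right)
  with assms show ?thesis
    unfolding LCP_SOL_def mem_Collect_eq by (simp add: less_eq_vec_def del: vector_add_component)
qed

lemma bounded_LCP_SOL:
  fixes A :: "real ^ 'n ^ 'n"
  assumes "LCP_SOL 0 A \<subseteq> {0}"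
  shows "bounded (LCP_SOL q A)"
proof -
  \<comment> \<open>Pairs of a scale \<open>t\<close> in [0, 1] and a unit vector solving the
    problem for \<open>t *\<^sub>R q\<close>.\<close>
  define K where
    "K = ({0..1} \<times> sphere 0 1) \<inter> (\<lambda>p. (fst p *\<^sub>R q, snd p)) -` {(q, z). z \<in> LCP_SOL q A}"
  have "compact K"
    unfolding K_def
    by (intro compact_Int_closed compact_Times closed_vimage closed_LCP_SOL_graph continuous_intros) auto
  then have "closed (fst ` K)"
    by (intro compact_imp_closed compact_continuous_image continuous_intros)
  \<comment> \<open>Scale 0 would give a unit vector solving the homogeneous problem.\<close>
  moreover have "0 \<notin> fst ` K"
    using assms by (auto simp: K_def)
  ultimately obtain e where e: "e > 0" "\<And>t. t \<in> fst ` K \<Longrightarrow> e \<le> dist 0 t"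
    using separate_point_closed by metis
  \<comment> \<open>The 1 covers solutions in the unit ball; outside it \<open>1 / norm z\<close> is
    below 1, hence a scale occurring in \<open>K\<close>.\<close>
  have "norm z \<le> max 1 (1 / e)" if z: "z \<in> LCP_SOL q A" for z
  proof (cases "norm z \<le> 1")
    case False
    then have "(1 / norm z, (1 / norm z) *\<^sub>R z) \<in> K"
      using LCP_SOL_scaleR[OF z, of "1 / norm z"] by (auto simp: K_def)
    then have "e \<le> 1 / norm z"
      using e(2)[of "1 / norm z"] by force
    moreover have "norm z > 0"
      using False by linarith
    ultimately have "norm z \<le> 1 / e"
      using e(1) by (simp add: pos_le_divide_eq mult.commute)
    then show ?thesis by simp
  qed simp
  then show ?thesis by (auto simp: bounded_iff)
qed

theorem theorem27:
  fixes A :: "real ^ 'n ^ 'n"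
  assumes "E0s_tilde_matrix A"
    and "game_value A > 0"
  shows "\<forall>q :: real ^ 'n. compact (LCP_SOL q A)"
proof -
  have "LCP_SOL 0 A \<subseteq> {0}"
    using assms by (intro E0s_matrix_LCP_SOL_zero) (auto simp: E0s_tilde_matrix_def)
  then show ?thesis
    by (simp add: compact_eq_bounded_closed bounded_LCP_SOL closed_LCP_SOL)
qed

end
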